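(* Let $(W_i)_{i\ge1}$, $W_i=(\psi_i,Y_i(0),Y_i(1))$, be i.i.d. with $\psi_i\in\mathbb{R}^d$ and $E[|\psi_1|_2^{\alpha}]<\infty$ for some $\alpha>d+1$. Let $q:\mathbb{R}^d\to(0,1]$ and $p:\mathbb{R}^d\to(0,1)$ be propensities each taking finitely many rational values. Let $\mathcal{G}_n^T$ be the partition of $\{1,\dots,n\}$ produced by the multi-level matching algorithm (described in the context) applied to the units $\{1,\dots,n\}$ with propensity $q$. Let $T_1,\dots,T_n\in\{0,1\}$ be sampling variables drawn by complete randomization within the groups of $\mathcal{G}_n^T$ (as described in the context), and let $\mathcal{G}_n^D$ be the partition of $\{i:T_i=1\}$ produced by the multi-level matching algorithm applied to the units $\{i:T_i=1\}$ with propensity $p$. Then, as $n\to\infty$, $$F(\mathcal{G}_n^T)=o_p(1),\qquad F(\mathcal{G}_n^D)=o_p(1),$$ where $F(\mathcal{G})=n^{-1}\sum_{g\in\mathcal{G}}\sum_{i\in g}|\psi_i-\bar\psi_g|_2^2$ and $\bar\psi_g=|g|^{-1}\sum_{i\in g}\psi_i$.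
   Context: Notation: $|\cdot|_2$ is the Euclidean norm; $\psi^{(j)}$ is the $j$-th coordinate of $\psi$; $a\wedge b=\min(a,b)$. Single-level algorithm. Input: a set of units $S\subseteq\{1,\dots,n\}$, covariates $\psi_i\in\mathbb{R}^d$, group size $k$, grid size (integer) $m\ge1$, iteration count $T\ge0$. (1) Preprocessing. Choose a remainder set $r\subseteq S$ with $|r|<k$ such that $S'=S\setminus r$ has cardinality divisible by $k$. For $i\in S'$ set $\phi_i^{(j)}=(\psi_i^{(j)}-\min_{i'\in S'}\psi_{i'}^{(j)})/(\max_{i'\in S'}\psi_{i'}^{(j)}-\min_{i'\in S'}\psi_{i'}^{(j)})$, so $\phi_i\in[0,1]^d$. (A coordinate with zero range over $S'$ is excluded from the sorting step; equivalently set $\phi_i^{(j)}=0$.) (2) Spatial sorting. Define $\rho_1(z_1)=z_1$ and, for $v\ge2$ and $z\in\{0,\dots,m-1\}^v$, $\rho_v(z_1,\dots,z_v)=z_v m^{v-1}+\rho_{v-1}(z_1,\dots,z_{v-1})$ if $z_v$ is even, and $\rho_v(z_1,\dots,z_v)=z_v m^{v-1}+m^{v-1}-1-\rho_{v-1}(z_1,\dots,z_{v-1})$ if $z_v$ is odd. For $x\in[0,1]^d$ let $\rho(x)=\rho_d(\lfloor m x\rfloor\wedge(m-1))$ (componentwise). Sort the units in $S'$ by $\rho(\phi_i)$, breaking ties at random, and match consecutive units into groups of size $k$. This gives a partition $\mathcal{G}^{(0)}$ of $S'$. (3) Balanced $k$-means polishing. Given $\mathcal{G}^{(t)}=\{g_1,\dots,g_K\}$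 with centroids $\bar\psi_{g_s}^{(t)}$, let $\mathcal{G}^{(t+1)}=\{g_1',\dots,g_K'\}$ minimize $\sum_{s=1}^K\sum_{i\in g_s'}|\psi_i-\bar\psi_{g_s}^{(t)}|_2^2$ over all labelled partitions of $S'$ into $K$ groups of size $k$. Run for $t=0,\dots,T-1$. Output: $\mathcal{G}^{(T)}\cup\{r\}$ (omitting $r$ if empty). Multi-level algorithm, for a unit set $S$ and a propensity with values $\{a_l/k_l:l=1,\dots,L\}$: split $S$ into the strata $S_l$ of units whose propensity value is $a_l/k_l$, run the single-level algorithm on each $S_l$ with group size $k_l$, remainder $r_l$, grid size $m_l\asymp(n_l/k_l)^{1/(d+1)}$ where $n_l=|S_l\setminus r_l|$ (ratio bounded above and below by positive constants when $n_l\ge1$), and any iteration count $T_l\ge0$; output the union over $l$. Complete randomization within groups: conditional on $W_1,\dots,W_n$ and the tie-breaking randomness (which is independent of the $W_i$), the vectors $(T_i)_{i\in g}$ are independent across $g\in\mathcal{G}_n^T$; for a full group of size $k_l$ at level $a_l/k_l$, $(T_i)_{i\in g}$ is uniform over binary vectors with exactly $a_l$ ones; for a remainder group the $T_i$ are i.i.d. Bernoulli$(a_l/k_l)$. *)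

theory Defs
  imports "HOL-Probability.Probability" "HOL-Combinatorics.Permutations"
begin

definition centroid :: "(nat \<Rightarrow> real ^ 'd) \<Rightarrow> nat set \<Rightarrow> real ^ 'd" where
  "centroid \<psi> g = (1 / real (card g)) *\<^sub>R (\<Sum>i\<in>g. \<psi> i)"

text \<open>A coordinate with zero range over \<open>S\<close> is mapped to 0, because \<open>x / 0 = 0\<close>.\<close>

definition normalized :: "(nat \<Rightarrow> real ^ 'd) \<Rightarrow> nat set \<Rightarrow> nat \<Rightarrow> real ^ 'd" where
  "normalized \<psi> S i =
     (\<chi> j. (\<psi> i $ j - Min ((\<lambda>i'. \<psi> i' $ j) ` S)) /
           (Max ((\<lambda>i'. \<psi> i' $ j) ` S) - Min ((\<lambda>i'. \<psi> i' $ j) ` S)))"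

text \<open>The vector \<open>(z\<^sub>1, \<dots>, z\<^sub>v)\<close> is encoded as a function on \<open>{1..v}\<close>; the case
  \<open>v = 0\<close> is a dummy.\<close>

fun rho :: "nat \<Rightarrow> nat \<Rightarrow> (nat \<Rightarrow> int) \<Rightarrow> int" where
  "rho m 0 z = 0"
| "rho m (Suc 0) z = z 1"
| "rho m (Suc (Suc v)) z =
     (if even (z (Suc (Suc v)))
      then z (Suc (Suc v)) * int m ^ Suc v + rho m (Suc v) z
      else z (Suc (Suc v)) * int m ^ Suc v + int m ^ Suc v - 1 - rho m (Suc v) z)"

text \<open>The index type \<open>'d\<close> of the coordinates carries no order; \<open>coord\<close> (a bijection from
  \<open>{1..CARD('d)}\<close>) says which coordinate is the first, the second, and so on.\<close>

definition cell_rank :: "(nat \<Rightarrow> 'd::finite) \<Rightarrow> nat \<Rightarrow> real ^ 'd \<Rightarrow> int" where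
  "cell_rank coord m x =
     rho m CARD('d) (\<lambda>j. min \<lfloor>real m * x $ coord j\<rfloor> (int m - 1))"

text \<open>The list \<open>xs\<close> enumerates \<open>S\<close> by increasing rank; ties are broken by the priorities
  \<open>\<tau>\<close>, which are going to be a uniformly random permutation of the units.\<close>

definition spatially_sorted ::
  "(nat \<Rightarrow> 'd::finite) \<Rightarrow> (nat \<Rightarrow> real ^ 'd) \<Rightarrow> (nat \<Rightarrow> nat) \<Rightarrow> nat \<Rightarrow> nat set \<Rightarrow> nat list \<Rightarrow> bool"
where
  "spatially_sorted coord \<psi> \<tau> m S xs \<longleftrightarrow>
     distinct xs \<and> set xs = S \<and>
     sorted_wrt (\<lambda>i j. let \<rho> = (\<lambda>i. cell_rank coord m (normalized \<psi> S i))
                       in \<rho> i < \<rho> j \<or> \<rho> i = \<rho> j \<and> \<tau> i < \<tau> j) xs"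

definition consecutive_groups :: "nat \<Rightarrow> nat list \<Rightarrow> nat \<Rightarrow> nat set" where
  "consecutive_groups k xs s = set (take k (drop (s * k) xs))"

definition labelled_partition :: "nat set \<Rightarrow> nat \<Rightarrow> nat \<Rightarrow> (nat \<Rightarrow> nat set) \<Rightarrow> bool" where
  "labelled_partition S K k g \<longleftrightarrow>
     disjoint_family_on g {..<K} \<and> (\<Union>s<K. g s) = S \<and> (\<forall>s<K. card (g s) = k)"

definition balanced_kmeans_step ::
  "(nat \<Rightarrow> real ^ 'd) \<Rightarrow> nat set \<Rightarrow> nat \<Rightarrow> nat \<Rightarrow> (nat \<Rightarrow> nat set) \<Rightarrow> (nat \<Rightarrow> nat set) \<Rightarrow> bool"
where
  "balanced_kmeans_step \<psi> S K k g g' \<longleftrightarrow>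
     is_arg_min (\<lambda>h. \<Sum>s<K. \<Sum>i\<in>h s. (norm (\<psi> i - centroid \<psi> (g s)))\<^sup>2)
                (labelled_partition S K k) g'"

text \<open>The algorithm leaves the remainder set and the choice among several minimizers open, so
  it is a relation: \<open>G\<close> is a possible output, with remainder set \<open>r\<close>, for the units \<open>S\<close>,
  group size \<open>k\<close>, grid size \<open>m\<close> and iteration count \<open>t\<close>.\<close>

definition single_level ::
  "(nat \<Rightarrow> 'd::finite) \<Rightarrow> (nat \<Rightarrow> real ^ 'd) \<Rightarrow> (nat \<Rightarrow> nat) \<Rightarrow> nat \<Rightarrow> nat \<Rightarrow> nat \<Rightarrow>
   nat set \<Rightarrow> nat set \<Rightarrow> nat set set \<Rightarrow> bool"
where
  "single_level coord \<psi> \<tau> k m t S r G \<longleftrightarrow>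
     r \<subseteq> S \<and> card r < k \<and> k dvd card (S - r) \<and>
     (\<exists>xs h. let K = card (S - r) div k in
        spatially_sorted coord \<psi> \<tau> m (S - r) xs \<and>
        h 0 = consecutive_groups k xs \<and>
        (\<forall>u<t. balanced_kmeans_step \<psi> (S - r) K k (h u) (h (Suc u))) \<and>
        G = h t ` {..<K} \<union> (if r = {} then {} else {r}))"

text \<open>\<open>q\<close> takes exactly the values \<open>a l / k l\<close>, \<open>1 \<le> l \<le> L\<close>, listed without repetition; the
  fractions need not be reduced.\<close>

definition propensity_levels ::
  "(real ^ 'd \<Rightarrow> real) \<Rightarrow> nat \<Rightarrow> (nat \<Rightarrow> nat) \<Rightarrow> (nat \<Rightarrow> nat) \<Rightarrow> bool"
where
  "propensity_levels q L a k \<longleftrightarrow>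
     (\<forall>l\<in>{1..L}. 1 \<le> k l) \<and>
     inj_on (\<lambda>l. real (a l) / real (k l)) {1..L} \<and>
     range q = (\<lambda>l. real (a l) / real (k l)) ` {1..L}"

definition stratum ::
  "(real ^ 'd \<Rightarrow> real) \<Rightarrow> (nat \<Rightarrow> nat) \<Rightarrow> (nat \<Rightarrow> nat) \<Rightarrow> (nat \<Rightarrow> real ^ 'd) \<Rightarrow> nat set \<Rightarrow> nat \<Rightarrow> nat set"
where
  "stratum q a k \<psi> S l = {i \<in> S. q (\<psi> i) = real (a l) / real (k l)}"

text \<open>\<open>c\<close> and \<open>C\<close> are the constants in \<open>m\<^sub>l \<asymp> (n\<^sub>l / k\<^sub>l) powr (1 / (d + 1))\<close>.\<close>

definition multi_level ::
  "(nat \<Rightarrow> 'd::finite) \<Rightarrow> real \<Rightarrow> real \<Rightarrow>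
   (real ^ 'd \<Rightarrow> real) \<Rightarrow> nat \<Rightarrow> (nat \<Rightarrow> nat) \<Rightarrow> (nat \<Rightarrow> nat) \<Rightarrow>
   (nat \<Rightarrow> real ^ 'd) \<Rightarrow> (nat \<Rightarrow> nat) \<Rightarrow> nat set \<Rightarrow> nat set set \<Rightarrow> bool"
where
  "multi_level coord c C q L a k \<psi> \<tau> S G \<longleftrightarrow>
     (\<exists>r m t H.
        (\<forall>l\<in>{1..L}.
           let S\<^sub>l = stratum q a k \<psi> S l;
               n\<^sub>l = card (S\<^sub>l - r l);
               b = (real n\<^sub>l / real (k l)) powr (1 / (real CARD('d) + 1))
           in 1 \<le> m l \<and>
              (1 \<le> n\<^sub>l \<longrightarrow> c \<le> real (m l) / b \<and> real (m l) / b \<le> C) \<and>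
              single_level coord \<psi> \<tau> (k l) (m l) (t l) S\<^sub>l (r l) (H l)) \<and>
        G = (\<Union>l\<in>{1..L}. H l))"

definition permutations_of_units :: "nat \<Rightarrow> (nat \<Rightarrow> nat) set" where
  "permutations_of_units n = {\<tau>. \<tau> permutes {1..n}}"

text \<open>The law of \<open>(T\<^sub>i)\<^bsub>i\<in>g\<^esub>\<close> for a group at level \<open>a / k\<close>. Remainder groups are exactly the
  groups with fewer than \<open>k\<close> elements.\<close>

definition group_law :: "nat \<Rightarrow> nat \<Rightarrow> nat set \<Rightarrow> (nat \<Rightarrow> nat) pmf" where
  "group_law a k g =
     (if card g = k
      then pmf_of_set {t \<in> g \<rightarrow>\<^sub>E {0, 1}. (\<Sum>i\<in>g. t i) = a}
      else Pi_pmf g undefined (\<lambda>_. map_pmf of_bool (bernoulli_pmf (real a / real k))))"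

text \<open>Conditionally on \<open>\<F>\<close>, the vectors \<open>(T\<^sub>i)\<^bsub>i\<in>g\<^esub>\<close>, \<open>g \<in> G\<close>, are independent with the above
  laws: the conditional joint probability mass function is the product over all groups,
  collected by level.\<close>

definition complete_randomization ::
  "'w measure \<Rightarrow> 'w measure \<Rightarrow> (real ^ 'd \<Rightarrow> real) \<Rightarrow> nat \<Rightarrow> (nat \<Rightarrow> nat) \<Rightarrow> (nat \<Rightarrow> nat) \<Rightarrow>
   nat \<Rightarrow> (nat \<Rightarrow> 'w \<Rightarrow> real ^ 'd) \<Rightarrow> ('w \<Rightarrow> nat set set) \<Rightarrow> (nat \<Rightarrow> 'w \<Rightarrow> nat) \<Rightarrow> bool"
where
  "complete_randomization M \<F> q L a k n \<psi> G T \<longleftrightarrow>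
     (\<forall>i\<in>{1..n}. T i \<in> M \<rightarrow>\<^sub>M count_space {0, 1}) \<and>
     (\<forall>t \<in> {1..n} \<rightarrow>\<^sub>E {0, 1}. AE \<omega> in M.
        real_cond_exp M \<F> (indicator {\<omega> \<in> space M. \<forall>i\<in>{1..n}. T i \<omega> = t i}) \<omega> =
        (\<Prod>l\<in>{1..L}. \<Prod>g \<in> {g \<in> G \<omega>. \<forall>i\<in>g. q (\<psi> i \<omega>) = real (a l) / real (k l)}.
           pmf (group_law (a l) (k l) g) (restrict t g)))"

text \<open>The library's \<open>indep_var\<close> needs both variables to have the same type.\<close>

definition independent_of ::
  "'w measure \<Rightarrow> 'a measure \<Rightarrow> ('w \<Rightarrow> 'a) \<Rightarrow> 'u measure \<Rightarrow> ('w \<Rightarrow> 'u) \<Rightarrow> bool"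
where
  "independent_of M A X B Y \<longleftrightarrow>
     X \<in> M \<rightarrow>\<^sub>M A \<and> Y \<in> M \<rightarrow>\<^sub>M B \<and>
     prob_space.indep_set M (sets (vimage_algebra (space M) X A)) (sets (vimage_algebra (space M) Y B))"

text \<open>The sub-\<open>\<sigma>\<close>-algebra of \<open>M\<close> generated by \<open>W\<^sub>1, \<dots>, W\<^sub>n\<close> and the seed \<open>\<xi>\<close>.\<close>

definition info ::
  "'w measure \<Rightarrow> nat \<Rightarrow> (nat \<Rightarrow> 'w \<Rightarrow> 'b::topological_space) \<Rightarrow> 'u measure \<Rightarrow> ('w \<Rightarrow> 'u) \<Rightarrow> 'w measure"
where
  "info M n W N \<xi> =
     vimage_algebra (space M) (\<lambda>\<omega>. (\<lambda>i\<in>{1..n}. W i \<omega>, \<xi> \<omega>))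
       ((\<Pi>\<^sub>M i\<in>{1..n}. borel) \<Otimes>\<^sub>M N)"

definition within_group_variation :: "nat \<Rightarrow> (nat \<Rightarrow> real ^ 'd) \<Rightarrow> nat set set \<Rightarrow> real" where
  "within_group_variation n \<psi> G =
     (1 / real n) * (\<Sum>g\<in>G. \<Sum>i\<in>g. (norm (\<psi> i - centroid \<psi> g))\<^sup>2)"

definition tends_to_0_in_prob :: "'w measure \<Rightarrow> (nat \<Rightarrow> 'w \<Rightarrow> real) \<Rightarrow> bool" where
  "tends_to_0_in_prob M X \<longleftrightarrow>
     (\<forall>\<epsilon>>0. (\<lambda>n. measure M {\<omega> \<in> space M. \<bar>X n \<omega>\<bar> > \<epsilon>}) \<longlonglongrightarrow> 0)"

end

theory Submission
  imports Defs
begin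

text \<open>
  The bound is deterministic in the units: if \<open>|\<psi>\<^sub>i| \<le> R\<close> for all \<open>i \<le> n\<close>, then \<open>F \<le> B R\<^sup>2 n powr (-2/(d+1))\<close>
  for every set of units and every output of the algorithm, so the randomization of the \<open>T\<^sub>i\<close> plays
  no role. A balanced k-means step does not increase the within-group variation, hence only the
  sorted groups matter. Consecutive cells of the snake order are adjacent, so a group whose ranks
  spread over \<open>\<delta>\<close> has normalized diameter at most \<open>min 1 ((\<delta> + 1) / m)\<close>, with square
  \<open>O(\<delta> / m + 1 / m\<^sup>2)\<close>. The spreads sum to at most \<open>m\<^sup>d\<close>, so \<open>K\<close> groups contribute
  \<open>O(m\<^bsup>d-1\<^esup> + K / m\<^sup>2)\<close>, which \<open>m \<asymp> K powr (1/(d+1))\<close> balances. Finally \<open>\<alpha> > d + 1\<close> and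
  Markov's inequality give \<open>max |\<psi>\<^sub>i| = o\<^sub>p(n powr (1/(d+1)))\<close>.
\<close>

section \<open>Within-group variation\<close>

definition variation :: "(nat \<Rightarrow> real ^ 'd) \<Rightarrow> nat set \<Rightarrow> real" where
  "variation \<psi> g = (\<Sum>i\<in>g. (norm (\<psi> i - centroid \<psi> g))\<^sup>2)"

lemma variation_nonneg: "variation \<psi> g \<ge> 0"
  by (simp add: variation_def sum_nonneg)

text \<open>Moving the reference point from the centroid to \<open>c\<close> adds exactly
  \<open>card g\<close> times the squared distance between the two, because the deviations from the
  centroid sum to zero and kill the cross term. The freedom in \<open>c\<close> is used for the old
  centroids of a k-means step, the first unit of a sorted group, and the origin.\<close>

lemma variation_le:
  fixes \<psi> :: "nat \<Rightarrow> real ^ 'd"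
  assumes "finite g"
  shows "variation \<psi> g \<le> (\<Sum>i\<in>g. (norm (\<psi> i - c))\<^sup>2)"
proof (cases "g = {}")
  case True
  then show ?thesis by (simp add: variation_def)
next
  case False
  let ?b = "centroid \<psi> g"
  have "(\<Sum>i\<in>g. \<psi> i - ?b) = 0"
    using assms False by (simp add: centroid_def sum_subtractf sum_constant_scaleR del: sum_constant)
  moreover have "(\<Sum>i\<in>g. (norm (\<psi> i - c))\<^sup>2)
      = (\<Sum>i\<in>g. (norm (\<psi> i - ?b))\<^sup>2 + 2 * ((\<psi> i - ?b) \<bullet> (?b - c)) + (norm (?b - c))\<^sup>2)"
    by (intro sum.cong refl) (simp add: power2_norm_eq_inner algebra_simps inner_commute)
  ultimately have "(\<Sum>i\<in>g. (norm (\<psi> i - c))\<^sup>2) = variation \<psi> g + real (card g) * (norm (?b - c))\<^sup>2"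
    by (simp add: variation_def sum.distrib sum_distrib_left[symmetric] inner_sum_left[symmetric])
  then show ?thesis by simp
qed

text \<open>Two minimizations are chained: \<open>g'\<close> beats the competitor \<open>g\<close>
  for the old centroids, and passing from the old centroids to those of \<open>g'\<close> lowers the
  sum again. The partition property is recorded so that steps can be iterated.\<close>

lemma balanced_kmeans_step_variation_le:
  fixes \<psi> :: "nat \<Rightarrow> real ^ 'd"
  assumes "finite S" "labelled_partition S K k g" "balanced_kmeans_step \<psi> S K k g g'"
  shows "labelled_partition S K k g'" "(\<Sum>s<K. variation \<psi> (g' s)) \<le> (\<Sum>s<K. variation \<psi> (g s))"
proof -
  show g': "labelled_partition S K k g'"
    using assms(3) by (simp add: balanced_kmeans_step_def is_arg_min_def)
  have fin: "finite (g' s)" if "s < K" for s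
    using g' assms(1) that by (metis UN_upper finite_subset labelled_partition_def lessThan_iff)
  have "(\<Sum>s<K. variation \<psi> (g' s)) \<le> (\<Sum>s<K. \<Sum>i\<in>g' s. (norm (\<psi> i - centroid \<psi> (g s)))\<^sup>2)"
    by (intro sum_mono variation_le fin) simp
  also have "\<dots> \<le> (\<Sum>s<K. variation \<psi> (g s))"
    using assms(2,3) unfolding balanced_kmeans_step_def is_arg_min_def variation_def by (meson not_less)
  finally show "(\<Sum>s<K. variation \<psi> (g' s)) \<le> (\<Sum>s<K. variation \<psi> (g s))" .
qed

section \<open>The snake order\<close>

text \<open>Each value of the last coordinate owns a block of \<open>m ^ Suc v\<close> ranks, and
  reversing a block for odd values leaves it in place.\<close>

lemma rho_bounds:
  assumes "\<And>j. j \<in> {1..v} \<Longrightarrow> 0 \<le> z j \<and> z j < int m" "v \<ge> 1"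
  shows "0 \<le> rho m v z \<and> rho m v z < int m ^ v"
  using assms
proof (induction m v z rule: rho.induct)
  case (3 m v z)
  define A where "A = int m ^ Suc v"
  define y where "y = z (Suc (Suc v))"
  have y: "0 \<le> y" "y + 1 \<le> int m"
    using "3.prems"(1)[of "Suc (Suc v)"] by (auto simp: y_def)
  have r: "0 \<le> rho m (Suc v) z" "rho m (Suc v) z < A"
    using 3 by (force simp: A_def)+
  have "(y + 1) * A \<le> int m * A" "0 \<le> y * A"
    using y r by (auto intro: mult_right_mono)
  then have "0 \<le> y * A" "y * A + A \<le> int m ^ Suc (Suc v)"
    by (simp_all add: A_def algebra_simps)
  then show ?case
    using r unfolding rho.simps A_def[symmetric] y_def[symmetric] by auto
qed auto

text \<open>Induction on the number of coordinates, comparing the last entries. In the same block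
  the induction hypothesis applies; in neighbouring blocks the reversal keeps the path continuous;
  otherwise a whole block of at least \<open>m\<close> ranks lies between the two cells, more than
  any coordinate can differ.\<close>

lemma cell_diff_le_rho_diff:
  assumes z: "\<And>j. j \<in> {1..v} \<Longrightarrow> 0 \<le> z j \<and> z j < int m"
    and z': "\<And>j. j \<in> {1..v} \<Longrightarrow> 0 \<le> z' j \<and> z' j < int m"
    and j: "j \<in> {1..v}"
  shows "\<bar>z j - z' j\<bar> \<le> \<bar>rho m v z - rho m v z'\<bar>"
  using assms
proof (induction v arbitrary: z z')
  case (Suc u)
  show ?case
  proof (cases u)
    case 0
    then show ?thesis using Suc.prems by simp
  next
    case (Suc v)
    \<comment> \<open>The vectors are quantified afresh, so that the opposite order of the last
      entries follows by swapping them.\<close>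
    have main: "\<bar>z j - z' j\<bar> \<le> \<bar>rho m (Suc u) z - rho m (Suc u) z'\<bar>"
      if le: "z (Suc u) \<le> z' (Suc u)"
        and z: "\<And>j. j \<in> {1..Suc u} \<Longrightarrow> 0 \<le> z j \<and> z j < int m"
        and z': "\<And>j. j \<in> {1..Suc u} \<Longrightarrow> 0 \<le> z' j \<and> z' j < int m" for z z'
    proof -
      define A where "A = int m ^ u"
      define r r' where "r = rho m u z" and "r' = rho m u z'"
      define y y' where "y = z (Suc u)" and "y' = z' (Suc u)"
      have r: "0 \<le> r \<and> r < A" and r': "0 \<le> r' \<and> r' < A"
        unfolding r_def r'_def A_def using z z' Suc by (intro rho_bounds; simp)+
      have m: "1 \<le> int m" using z[of 1] by simp
      \<comment> \<open>This uses that \<open>u\<close> is at least 1; for \<open>u = 0\<close> a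
        block is a single rank.\<close>
      have mA: "int m \<le> A" using m power_increasing[of 1 u "int m"] Suc by (simp add: A_def)
      have rz: "rho m (Suc u) z = (if even y then y * A + r else y * A + A - 1 - r)"
        and rz': "rho m (Suc u) z' = (if even y' then y' * A + r' else y' * A + A - 1 - r')"
        by (simp_all add: Suc A_def r_def r'_def y_def y'_def)
      have IH: "\<bar>z j - z' j\<bar> \<le> \<bar>r - r'\<bar>" if "j \<noteq> Suc u"
        unfolding r_def r'_def using z z' that Suc.prems(3) by (intro Suc.IH) auto
      have jlt: "\<bar>z j - z' j\<bar> < int m" using z[OF Suc.prems(3)] z'[OF Suc.prems(3)] by auto
      consider "y' = y" | "y' = y + 1" | "y' \<ge> y + 2" using le y_def y'_def by linarith
      then show ?thesis
      proof cases
        case 1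
        then show ?thesis using IH rz rz' by (cases "j = Suc u") (auto simp: y_def y'_def)
      next
        case 2
        \<comment> \<open>The ranks differ by \<open>r + r' + 1\<close> if \<open>y\<close> is odd
          and by \<open>2 * A - 1 - r - r'\<close> if \<open>y\<close> is even. The 1 serves the
          last coordinate, \<open>\<bar>r - r'\<bar>\<close> the others.\<close>
        have "1 + \<bar>r - r'\<bar> \<le> rho m (Suc u) z' - rho m (Suc u) z"
          unfolding rz rz' 2 using r r' by (auto simp: algebra_simps)
        then show ?thesis using IH 2 by (cases "j = Suc u") (auto simp: y_def y'_def)
      next
        case 3
        have "(y' - y - 1) * A + 1 \<le> rho m (Suc u) z' - rho m (Suc u) z"
          unfolding rz rz' using r r' by (auto simp: algebra_simps)
        moreover have "1 * A \<le> (y' - y - 1) * A"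
          using 3 r by (intro mult_right_mono) auto
        ultimately show ?thesis using jlt mA by linarith
      qed
    qed
    show ?thesis
    proof (cases "z (Suc u) \<le> z' (Suc u)")
      case True
      then show ?thesis using main[of z z'] Suc.prems by blast
    next
      case False
      then show ?thesis using main[of z' z] Suc.prems by (simp add: abs_minus_commute)
    qed
  qed
qed simp

section \<open>Grid cells and normalized coordinates\<close>

definition cell_index :: "nat \<Rightarrow> real \<Rightarrow> int" where
  "cell_index m x = min \<lfloor>real m * x\<rfloor> (int m - 1)"

lemma cell_index_bounds:
  assumes "0 \<le> x" "1 \<le> m"
  shows "0 \<le> cell_index m x \<and> cell_index m x < int m"
  using assms by (auto simp: cell_index_def)

text \<open>For positive \<open>m\<close> the cap at \<open>int m - 1\<close> acts only at
  \<open>x = 1\<close>, which it puts at the right end of the last cell.\<close>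

lemma cell_index_approx:
  assumes "x \<le> 1"
  shows "real_of_int (cell_index m x) \<le> real m * x"
    "real m * x \<le> real_of_int (cell_index m x) + 1"
proof -
  show "real_of_int (cell_index m x) \<le> real m * x"
    unfolding cell_index_def using of_int_floor_le[of "real m * x"] by (simp add: min_def) linarith
  have "real m * x \<le> real m" using assms by (simp add: mult_left_le)
  then show "real m * x \<le> real_of_int (cell_index m x) + 1"
    unfolding cell_index_def using floor_correct[of "real m * x"] by (simp add: min_def)
qed

lemma cell_rank_bounds:
  fixes coord :: "nat \<Rightarrow> 'd::finite"
  assumes "1 \<le> m" "\<And>j. 0 \<le> x $ j"
  shows "0 \<le> cell_rank coord m x \<and> cell_rank coord m x < int m ^ CARD('d)"
  using rho_bounds[of "CARD('d)" "\<lambda>j. cell_index m (x $ coord j)" m] cell_index_bounds assms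
  by (simp add: cell_rank_def cell_index_def)

text \<open>The snake order bounds the difference of the cell indices; the extra 1 pays for the
  positions inside the two cells.\<close>

lemma coordinate_diff_le_cell_rank:
  fixes coord :: "nat \<Rightarrow> 'd::finite"
  assumes coord: "bij_betw coord {1..CARD('d)} UNIV" and m: "1 \<le> m"
    and x: "\<And>j. 0 \<le> x $ j \<and> x $ j \<le> 1" and y: "\<And>j. 0 \<le> y $ j \<and> y $ j \<le> 1"
  shows "real m * \<bar>x $ j - y $ j\<bar> \<le> real_of_int \<bar>cell_rank coord m x - cell_rank coord m y\<bar> + 1"
proof -
  obtain i where i: "i \<in> {1..CARD('d)}" "j = coord i"
    using coord by (metis UNIV_I bij_betw_imp_surj_on imageE)
  have "\<bar>cell_index m (x $ j) - cell_index m (y $ j)\<bar> \<le> \<bar>cell_rank coord m x - cell_rank coord m y\<bar>"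
    unfolding cell_rank_def cell_index_def[symmetric] i(2)
    using x y m i(1) cell_index_bounds
    by (intro cell_diff_le_rho_diff[where z = "\<lambda>i. cell_index m (x $ coord i)"
          and z' = "\<lambda>i. cell_index m (y $ coord i)"]) auto
  moreover have "real m * \<bar>x $ j - y $ j\<bar> = \<bar>real m * x $ j - real m * y $ j\<bar>"
    by (simp add: abs_mult right_diff_distrib[symmetric])
  ultimately show ?thesis
    using x[of j] y[of j] cell_index_approx[of "x $ j" m] cell_index_approx[of "y $ j" m] by linarith
qed

lemma normalized_bounds:
  assumes "finite S" "i \<in> S"
  shows "0 \<le> normalized \<psi> S i $ j \<and> normalized \<psi> S i $ j \<le> 1"
proof -
  have "Min ((\<lambda>i'. \<psi> i' $ j) ` S) \<le> \<psi> i $ j" "\<psi> i $ j \<le> Max ((\<lambda>i'. \<psi> i' $ j) ` S)"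
    using assms by (auto intro: Min_le Max_ge)
  then show ?thesis by (simp add: normalized_def divide_le_eq)
qed

text \<open>Normalization divides by the range of the coordinate, which is at most
  \<open>2 * R\<close> since a coordinate is bounded by the norm. With zero range the normalized
  values are all 0, but then the original coordinates agree as well.\<close>

lemma coordinate_diff_le_normalized:
  assumes "finite S" "i \<in> S" "i' \<in> S" "\<And>i. i \<in> S \<Longrightarrow> norm (\<psi> i) \<le> R"
  shows "\<bar>\<psi> i $ j - \<psi> i' $ j\<bar> \<le> 2 * R * \<bar>normalized \<psi> S i $ j - normalized \<psi> S i' $ j\<bar>"
proof -
  define a b where "a = Min ((\<lambda>i'. \<psi> i' $ j) ` S)" and "b = Max ((\<lambda>i'. \<psi> i' $ j) ` S)"
  have ab: "a \<le> \<psi> l $ j" "\<psi> l $ j \<le> b" if "l \<in> S" for l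
    using assms that by (auto intro: Min_le Max_ge simp: a_def b_def)
  have bd: "\<bar>\<psi> l $ j\<bar> \<le> R" if "l \<in> S" for l
    using assms(4)[OF that] component_le_norm_cart[of "\<psi> l" j] by linarith
  have "a \<in> (\<lambda>i'. \<psi> i' $ j) ` S" "b \<in> (\<lambda>i'. \<psi> i' $ j) ` S"
    unfolding a_def b_def using assms by (auto intro!: Min_in Max_in)
  then obtain l l' where "l \<in> S" "a = \<psi> l $ j" "l' \<in> S" "b = \<psi> l' $ j" by auto
  then have "b - a \<le> 2 * R" using bd[of l] bd[of l'] by linarith
  show ?thesis
  proof (cases "a = b")
    case True
    then have "\<psi> i $ j = \<psi> i' $ j" using ab[of i] ab[of i'] assms by auto
    moreover have "0 \<le> R" using bd[OF assms(2)] by linarith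
    ultimately show ?thesis by simp
  next
    case False
    then have lt: "a < b" using ab[of i] assms by auto
    have "normalized \<psi> S i $ j - normalized \<psi> S i' $ j = (\<psi> i $ j - \<psi> i' $ j) / (b - a)"
      by (simp add: normalized_def a_def b_def diff_divide_distrib[symmetric])
    then have "\<bar>\<psi> i $ j - \<psi> i' $ j\<bar> = (b - a) * \<bar>normalized \<psi> S i $ j - normalized \<psi> S i' $ j\<bar>"
      using lt by (simp add: abs_mult)
    also have "\<dots> \<le> 2 * R * \<bar>normalized \<psi> S i $ j - normalized \<psi> S i' $ j\<bar>"
      using \<open>b - a \<le> 2 * R\<close> by (rule mult_right_mono) simp
    finally show ?thesis .
  qed
qed

text \<open>The linear term \<open>\<delta> / m\<close> in the bound on the square uses that normalized distances are at
  most 1; summing distances instead of squared distances would force \<open>\<alpha> \<ge> 2 (d + 1)\<close>.\<close>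

lemma norm_diff_le_cell_rank:
  fixes coord :: "nat \<Rightarrow> 'd::finite" and R \<delta> :: real
  assumes "bij_betw coord {1..CARD('d)} UNIV" and m: "1 \<le> m"
    and S: "finite S" "i \<in> S" "i' \<in> S" "\<And>i. i \<in> S \<Longrightarrow> norm (\<psi> i) \<le> R"
    and \<delta>: "real_of_int \<bar>cell_rank coord m (normalized \<psi> S i) - cell_rank coord m (normalized \<psi> S i')\<bar> \<le> \<delta>"
  shows "(norm (\<psi> i - \<psi> i'))\<^sup>2 \<le> 8 * real CARD('d) * R\<^sup>2 * (\<delta> / m + 1 / (real m)\<^sup>2)"
proof -
  have "((\<psi> i - \<psi> i') $ j)\<^sup>2 \<le> 8 * R\<^sup>2 * (\<delta> / m + 1 / (real m)\<^sup>2)" for j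
  proof -
    define x where "x = \<bar>normalized \<psi> S i $ j - normalized \<psi> S i' $ j\<bar>"
    have x1: "0 \<le> x" "x \<le> 1"
      using normalized_bounds[OF S(1,2), of \<psi> j] normalized_bounds[OF S(1,3), of \<psi> j]
      by (auto simp: x_def)
    have "real m * x \<le> \<delta> + 1"
      using coordinate_diff_le_cell_rank[OF assms(1) m, of "normalized \<psi> S i" "normalized \<psi> S i'" j] \<delta>
        normalized_bounds[OF S(1,2), of \<psi>] normalized_bounds[OF S(1,3), of \<psi>]
      by (auto simp: x_def)
    then have x2: "x \<le> \<delta> / m + 1 / m" using m by (simp add: field_simps)
    have "0 \<le> \<delta>" using \<delta> by linarith
    \<comment> \<open>Truncating at 1 gives \<open>u\<^sup>2 \<le> u \<le> \<delta> / m\<close>,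
      which turns the square into a linear term; \<open>x \<le> u + 1 / m\<close> survives because
      \<open>x\<close> is at most 1.\<close>
    define u where "u = min 1 (\<delta> / m)"
    have u: "0 \<le> u" "u \<le> 1" "u \<le> \<delta> / m" using \<open>0 \<le> \<delta>\<close> by (auto simp: u_def)
    have "x \<le> u + 1 / m" using x1 x2 by (auto simp: u_def min_def intro: add_increasing2)
    then have "x\<^sup>2 \<le> (u + 1 / m)\<^sup>2" using x1 by (intro power_mono) auto
    also have "\<dots> \<le> 2 * u\<^sup>2 + 2 * (1 / m)\<^sup>2"
      using sum_squares_bound[of u "1 / m"] by (simp add: power2_sum)
    also have "u\<^sup>2 \<le> \<delta> / m" using u mult_left_le[of u u] by (simp add: power2_eq_square)
    finally have x3: "x\<^sup>2 \<le> 2 * (\<delta> / m + 1 / (real m)\<^sup>2)" by (simp add: power_divide)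
    \<comment> \<open>The constant 8 is the 4 from squaring \<open>2 * R\<close> times the 2 from
      splitting \<open>(u + 1 / m)\<^sup>2\<close>.\<close>
    have "((\<psi> i - \<psi> i') $ j)\<^sup>2 \<le> (2 * R * x)\<^sup>2"
      using coordinate_diff_le_normalized[where \<psi> = \<psi> and j = j, OF S]
      unfolding x_def by (metis abs_ge_zero power2_abs power_mono vector_minus_component)
    also have "\<dots> = 4 * R\<^sup>2 * x\<^sup>2" by (simp add: power_mult_distrib)
    also have "\<dots> \<le> 4 * R\<^sup>2 * (2 * (\<delta> / m + 1 / (real m)\<^sup>2))"
      using x3 by (intro mult_left_mono) auto
    finally show ?thesis by (simp add: algebra_simps)
  qed
  then have "(\<Sum>j\<in>UNIV. ((\<psi> i - \<psi> i') $ j)\<^sup>2) \<le> (\<Sum>j\<in>(UNIV::'d set). 8 * R\<^sup>2 * (\<delta> / m + 1 / (real m)\<^sup>2))"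
    by (intro sum_mono) auto
  then show ?thesis
    by (simp add: norm_vec_def L2_set_def sum_nonneg algebra_simps)
qed

section \<open>Matched groups\<close>

lemma consecutive_groups_nth:
  assumes "s < K" "length xs = K * k"
  shows "consecutive_groups k xs s = (\<lambda>p. xs ! (s * k + p)) ` {..<k}"
proof -
  have "(s + 1) * k \<le> K * k" using assms by (intro mult_right_mono) auto
  then have "s * k + k \<le> length xs" using assms by (simp add: algebra_simps)
  then have "length (take k (drop (s * k) xs)) = k" by simp
  then have "consecutive_groups k xs s = (!) (take k (drop (s * k) xs)) ` {..<k}"
    unfolding consecutive_groups_def by (auto simp: set_conv_nth simp del: nth_take)
  also have "\<dots> = (\<lambda>p. xs ! (s * k + p)) ` {..<k}"
    using \<open>s * k + k \<le> length xs\<close> by (intro image_cong) auto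
  finally show ?thesis .
qed

text \<open>Division with remainder: the position \<open>s * k + p\<close> with \<open>p < k\<close>
  determines \<open>s\<close> and \<open>p\<close>, and position \<open>i\<close> lies in group
  \<open>i div k\<close>.\<close>

lemma labelled_partition_consecutive_groups:
  assumes "distinct xs" "length xs = K * k" "0 < k"
  shows "labelled_partition (set xs) K k (consecutive_groups k xs)"
proof -
  have lt: "s * k + p < length xs" if "s < K" "p < k" for s p
  proof -
    have "(s + 1) * k \<le> K * k" using that by (intro mult_right_mono) auto
    then show ?thesis using that assms by (simp add: algebra_simps)
  qed
  have inj: "s = s' \<and> p = p'"
    if "xs ! (s * k + p) = xs ! (s' * k + p')" "s < K" "p < k" "s' < K" "p' < k" for s p s' p'
  proof -
    have "s * k + p = s' * k + p'" using that lt assms(1) nth_eq_iff_index_eq by blast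
    then have "(s * k + p) div k = (s' * k + p') div k" "(s * k + p) mod k = (s' * k + p') mod k"
      by simp_all
    then show ?thesis using that by simp
  qed
  have "disjoint_family_on (consecutive_groups k xs) {..<K}"
  proof (unfold disjoint_family_on_def, intro ballI impI)
    fix s s' assume s: "s \<in> {..<K}" "s' \<in> {..<K}" "s \<noteq> s'"
    show "consecutive_groups k xs s \<inter> consecutive_groups k xs s' = {}"
    proof (rule ccontr)
      assume "consecutive_groups k xs s \<inter> consecutive_groups k xs s' \<noteq> {}"
      then obtain p p' where "p < k" "p' < k" "xs ! (s * k + p) = xs ! (s' * k + p')"
        using s consecutive_groups_nth[OF _ assms(2)] by auto
      then show False using inj s by blast
    qed
  qed
  moreover have "(\<Union>s<K. consecutive_groups k xs s) = set xs"
  proof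
    show "(\<Union>s<K. consecutive_groups k xs s) \<subseteq> set xs"
      by (auto simp: consecutive_groups_def dest: in_set_takeD in_set_dropD)
    show "set xs \<subseteq> (\<Union>s<K. consecutive_groups k xs s)"
    proof
      fix x assume "x \<in> set xs"
      then obtain i where i: "i < K * k" "x = xs ! i" using assms(2) by (auto simp: set_conv_nth)
      then have "i div k < K" by (simp add: less_mult_imp_div_less)
      moreover have "x = xs ! (i div k * k + i mod k)" "i mod k < k" using i assms(3) by simp_all
      ultimately show "x \<in> (\<Union>s<K. consecutive_groups k xs s)"
        using consecutive_groups_nth[OF _ assms(2), of "i div k"] by blast
    qed
  qed
  moreover have "card (consecutive_groups k xs s) = k" if "s < K" for s
    using inj[where s = s and s' = s] that
    by (subst consecutive_groups_nth[OF that assms(2)]) (simp add: card_image inj_on_def)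
  ultimately show ?thesis by (simp add: labelled_partition_def)
qed

text \<open>Every unit is compared with the first one of its group, so only the rank spread of the
  group matters. The spreads cover successive stretches of the \<open>m ^ CARD('d)\<close> ranks,
  and dividing their sum by \<open>m\<close> leaves the power \<open>CARD('d) - 1\<close>.\<close>

lemma consecutive_groups_variation:
  fixes coord :: "nat \<Rightarrow> 'd::finite" and R :: real
  assumes coord: "bij_betw coord {1..CARD('d)} UNIV" and m: "1 \<le> m"
    and S: "finite S" "\<And>i. i \<in> S \<Longrightarrow> norm (\<psi> i) \<le> R"
    and sorted: "spatially_sorted coord \<psi> \<tau> m S xs"
    and len: "length xs = K * k" and k: "0 < k"
  shows "(\<Sum>s<K. variation \<psi> (consecutive_groups k xs s))
    \<le> 8 * real CARD('d) * real k * R\<^sup>2 * (real m ^ (CARD('d) - 1) + K / (real m)\<^sup>2)"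
proof -
  define f where "f i = cell_rank coord m (normalized \<psi> S i)" for i
  \<comment> \<open>The value past the end of the list makes the sum of the spreads telescope.\<close>
  define F where "F p = (if p < K * k then f (xs ! p) else int m ^ CARD('d))" for p
  have xs: "distinct xs" "set xs = S"
    and sw: "sorted_wrt (\<lambda>i j. f i < f j \<or> f i = f j \<and> \<tau> i < \<tau> j) xs"
    using sorted by (auto simp: spatially_sorted_def f_def)
  have f: "0 \<le> f i \<and> f i < int m ^ CARD('d)" if "i \<in> S" for i
    unfolding f_def using normalized_bounds[OF S(1) that] m by (intro cell_rank_bounds) auto
  have inS: "xs ! p \<in> S" if "p < K * k" for p using that xs(2) len nth_mem by metis
  have mono: "F p \<le> F p'" if "p \<le> p'" for p p'
  proof (cases "p' < K * k \<and> p < p'")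
    case True
    then show ?thesis using sorted_wrt_nth_less[OF sw, of p p'] len by (auto simp: F_def)
  next
    case False
    then show ?thesis using that f inS by (auto simp: F_def not_less less_imp_le dest: order_antisym)
  qed
  \<comment> \<open>The spread runs to the first unit of the next group instead of the last unit of
    group \<open>s\<close>: possibly larger, but consecutive spreads then join without gaps.\<close>
  define D where "D s = real_of_int (F (Suc s * k) - F (s * k))" for s
  have group: "variation \<psi> (consecutive_groups k xs s) \<le> real k * (8 * real CARD('d) * R\<^sup>2 * (D s / m + 1 / (real m)\<^sup>2))"
    (is "_ \<le> real k * ?B") if s: "s < K" for s
  proof -
    let ?g = "consecutive_groups k xs s"
    have lt: "s * k + p < K * k" if "p < k" for p
    proof -
      have "(s + 1) * k \<le> K * k" using s by (intro mult_right_mono) auto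
      then show ?thesis using that by (simp add: algebra_simps)
    qed
    have "card ?g = k" "finite ?g"
      using labelled_partition_consecutive_groups[OF xs(1) len k] s
      by (auto simp: labelled_partition_def consecutive_groups_def)
    have "variation \<psi> ?g \<le> (\<Sum>i\<in>?g. (norm (\<psi> i - \<psi> (xs ! (s * k))))\<^sup>2)"
      using \<open>finite ?g\<close> by (rule variation_le)
    also have "\<dots> \<le> (\<Sum>i\<in>?g. ?B)"
    proof (rule sum_mono)
      fix i assume "i \<in> ?g"
      then obtain p where p: "p < k" "i = xs ! (s * k + p)"
        using consecutive_groups_nth[OF s len] by auto
      have "F (s * k) \<le> F (s * k + p)" "F (s * k + p) \<le> F (Suc s * k)"
        using p by (intro mono; simp)+
      moreover have "F (s * k + p) = f i" "F (s * k) = f (xs ! (s * k))"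
        using lt[of p] lt[of 0] p k by (simp_all add: F_def)
      ultimately have "real_of_int \<bar>f i - f (xs ! (s * k))\<bar> \<le> D s"
        by (simp add: D_def)
      then show "(norm (\<psi> i - \<psi> (xs ! (s * k))))\<^sup>2 \<le> ?B"
        using lt[of p] lt[of 0] p k S
        by (intro norm_diff_le_cell_rank[OF coord m S(1)]) (auto simp: f_def intro: inS)
    qed
    finally show ?thesis using \<open>card ?g = k\<close> by simp
  qed
  have "(\<Sum>s<K. D s) = real_of_int (F (K * k) - F 0)"
    unfolding D_def using sum_lessThan_telescope[of "\<lambda>s. real_of_int (F (s * k))" K] by simp
  \<comment> \<open>\<open>F (K * k)\<close> is the value past the end and \<open>F 0\<close> is
    nonnegative; for \<open>K = 0\<close> both are that value.\<close>
  also have "\<dots> \<le> real m ^ CARD('d)"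
    using f[OF inS, of 0] by (auto simp: F_def)
  finally have "(\<Sum>s<K. D s) / m \<le> real m ^ CARD('d) / m" by (rule divide_right_mono) simp
  also have "\<dots> = real m ^ (CARD('d) - 1)" using m by (simp add: power_diff)
  finally have D: "(\<Sum>s<K. D s) / m \<le> real m ^ (CARD('d) - 1)" .
  have "(\<Sum>s<K. variation \<psi> (consecutive_groups k xs s))
    \<le> (\<Sum>s<K. k * (8 * real CARD('d) * R\<^sup>2 * (D s / m + 1 / (real m)\<^sup>2)))"
    using group by (intro sum_mono) auto
  also have "\<dots> = 8 * real CARD('d) * real k * R\<^sup>2 * ((\<Sum>s<K. D s) / m + K / (real m)\<^sup>2)"
    by (simp add: sum.distrib sum_divide_distrib sum_distrib_left algebra_simps)
  also have "\<dots> \<le> 8 * real CARD('d) * real k * R\<^sup>2 * (real m ^ (CARD('d) - 1) + K / (real m)\<^sup>2)"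
    using D by (intro mult_left_mono) auto
  finally show ?thesis .
qed

section \<open>From one level of the algorithm to all levels\<close>

lemma sum_Un_le_add:
  fixes f :: "'a \<Rightarrow> real"
  assumes "finite A" "finite B" "\<And>x. 0 \<le> f x"
  shows "sum f (A \<union> B) \<le> sum f A + sum f B"
  using sum.union_inter[OF assms(1,2), of f] sum_nonneg[of "A \<inter> B" f] assms(3) by simp

text \<open>Nonnegativity replaces disjointness, so groups from different levels need not be shown
  to be distinct.\<close>

lemma sum_UN_le_sum:
  fixes f :: "'a \<Rightarrow> real"
  assumes "finite I" "\<And>i. i \<in> I \<Longrightarrow> finite (A i)" "\<And>x. 0 \<le> f x"
  shows "sum f (\<Union>i\<in>I. A i) \<le> (\<Sum>i\<in>I. sum f (A i))"
  using assms(1,2)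
proof (induction I)
  case (insert i I)
  then show ?case
    using sum_Un_le_add[of "A i" "\<Union>j\<in>I. A j" f] assms(3) by fastforce
qed simp

text \<open>Iterating the k-means monotonicity leads back to the sorted groups. The premise on
  \<open>B\<close> is conditional because the grid size is controlled only when some unit is
  matched; otherwise there is no full group and \<open>0 \<le> B\<close> suffices. The remainder,
  with fewer than \<open>k\<close> units, accounts for \<open>k * R\<^sup>2\<close>.\<close>

lemma single_level_variation:
  fixes coord :: "nat \<Rightarrow> 'd::finite" and R B :: real
  assumes coord: "bij_betw coord {1..CARD('d)} UNIV" and m: "1 \<le> m"
    and S: "finite S" "\<And>i. i \<in> S \<Longrightarrow> norm (\<psi> i) \<le> R"
    and G: "single_level coord \<psi> \<tau> k m t S r G" and k: "0 < k"
    and B: "card (S - r) \<noteq> 0 \<Longrightarrow> 8 * real CARD('d) * real k * R\<^sup>2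
        * (real m ^ (CARD('d) - 1) + (card (S - r) div k) / (real m)\<^sup>2) \<le> B" "0 \<le> B"
  shows "finite G"
    and "(\<Sum>g\<in>G. variation \<psi> g) \<le> B + k * R\<^sup>2"
proof -
  define K where "K = card (S - r) div k"
  have r: "r \<subseteq> S" "card r < k" "k dvd card (S - r)"
    using G by (auto simp: single_level_def)
  obtain xs h where sorted: "spatially_sorted coord \<psi> \<tau> m (S - r) xs"
    and h0: "h 0 = consecutive_groups k xs"
    and step: "\<And>u. u < t \<Longrightarrow> balanced_kmeans_step \<psi> (S - r) K k (h u) (h (Suc u))"
    and Geq: "G = h t ` {..<K} \<union> (if r = {} then {} else {r})"
    using G unfolding single_level_def Let_def K_def by blast
  show "finite G" using Geq by simp
  have xs: "distinct xs" "set xs = S - r" using sorted by (auto simp: spatially_sorted_def)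
  have len: "length xs = K * k"
    using xs r(3) distinct_card[of xs] by (simp add: K_def)
  have fin: "finite (S - r)" using S by simp
  have *: "labelled_partition (S - r) K k (h u) \<and>
      (\<Sum>s<K. variation \<psi> (h u s)) \<le> (\<Sum>s<K. variation \<psi> (h 0 s))" if "u \<le> t" for u
    using that
  proof (induction u)
    case 0
    then show ?case using labelled_partition_consecutive_groups[OF xs(1) len k] xs h0 by simp
  next
    case (Suc u)
    then show ?case
      using balanced_kmeans_step_variation_le[OF fin, of K k "h u" \<psi> "h (Suc u)"] step[of u] by force
  qed
  \<comment> \<open>Equal groups would count only once on the left; nonnegativity makes the labelled
    sum an upper bound in any case.\<close>
  have "(\<Sum>g\<in>h t ` {..<K}. variation \<psi> g) \<le> (\<Sum>s<K. variation \<psi> (h t s))"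
    using sum_image_le[of "{..<K}" "variation \<psi>" "h t", OF finite_lessThan variation_nonneg] by (simp add: o_def)
  also have "\<dots> \<le> (\<Sum>s<K. variation \<psi> (h 0 s))" using *[of t] by simp
  also have "\<dots> \<le> 8 * real CARD('d) * real k * R\<^sup>2 * (real m ^ (CARD('d) - 1) + K / (real m)\<^sup>2)"
    unfolding h0 using S by (intro consecutive_groups_variation[OF coord m fin _ sorted len k]) auto
  finally have main: "(\<Sum>g\<in>h t ` {..<K}. variation \<psi> g) \<le> B"
    using B by (cases "card (S - r) = 0") (auto simp: K_def)
  have "variation \<psi> r \<le> (\<Sum>i\<in>r. (norm (\<psi> i - 0))\<^sup>2)"
    using r S by (intro variation_le) (auto intro: finite_subset)
  also have "\<dots> \<le> (\<Sum>i\<in>r. R\<^sup>2)"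
    using r S by (intro sum_mono power_mono) auto
  also have "\<dots> \<le> k * R\<^sup>2" using r by (auto intro!: mult_right_mono)
  finally have rem: "(\<Sum>g\<in>(if r = {} then {} else {r}). variation \<psi> g) \<le> k * R\<^sup>2" by simp
  have "(\<Sum>g\<in>G. variation \<psi> g) \<le> (\<Sum>g\<in>h t ` {..<K}. variation \<psi> g)
      + (\<Sum>g\<in>(if r = {} then {} else {r}). variation \<psi> g)"
    unfolding Geq by (intro sum_Un_le_add variation_nonneg) auto
  then show "(\<Sum>g\<in>G. variation \<psi> g) \<le> B + k * R\<^sup>2"
    using main rem by linarith
qed

text \<open>With \<open>m\<close> of the order of \<open>b\<close>, both terms have the order
  \<open>K powr (1 - 2 / (d + 1))\<close>: the first because
  \<open>(d - 1) / (d + 1) = 1 - 2 / (d + 1)\<close>, the second because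
  \<open>b\<^sup>2 = K powr (2 / (d + 1))\<close>. The exponent is nonnegative for
  \<open>d \<ge> 1\<close>, so \<open>K\<close> may be enlarged to \<open>n\<close>.\<close>

lemma grid_size_bound:
  fixes c C n K :: real and m d :: nat
  defines "b \<equiv> K powr (1 / (real d + 1))"
  assumes m: "1 \<le> m" and d: "1 \<le> d" and K: "0 < K" "K \<le> n" and c: "0 < c"
    and lo: "c \<le> real m / b" and up: "real m / b \<le> C"
  shows "real m ^ (d - 1) + K / (real m)\<^sup>2 \<le> (C ^ (d - 1) + 1 / c\<^sup>2) * n powr (1 - 2 / (real d + 1))"
proof -
  let ?e = "1 - 2 / (real d + 1)"
  have b: "0 < b" using K by (simp add: b_def)
  have le: "K powr ?e \<le> n powr ?e" using K d by (intro powr_mono2) auto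
  have "b ^ (d - 1) = K powr (1 / (real d + 1) * real (d - 1))"
    unfolding b_def using K by (simp add: powr_powr powr_realpow[symmetric])
  also have "1 / (real d + 1) * real (d - 1) = ?e"
    using d by (simp add: field_simps of_nat_diff)
  finally have bd: "b ^ (d - 1) = K powr ?e" .
  have "real m ^ (d - 1) \<le> (C * b) ^ (d - 1)"
    using up b by (intro power_mono) (auto simp: field_simps)
  then have 1: "real m ^ (d - 1) \<le> C ^ (d - 1) * K powr ?e"
    unfolding power_mult_distrib bd .
  have "c * b \<le> m" using lo b by (simp add: field_simps)
  then have "(c * b)\<^sup>2 \<le> (real m)\<^sup>2" using b c by (intro power_mono) auto
  then have "K / (real m)\<^sup>2 \<le> K / (c * b)\<^sup>2"
    using K b c m by (intro divide_left_mono) auto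
  also have "b\<^sup>2 = K powr (2 / (real d + 1))"
    unfolding b_def using K by (simp add: powr_powr powr_realpow[symmetric])
  then have "K / (c * b)\<^sup>2 = 1 / c\<^sup>2 * K powr ?e"
    using K by (simp add: power_mult_distrib powr_diff)
  finally have 2: "K / (real m)\<^sup>2 \<le> 1 / c\<^sup>2 * K powr ?e" .
  have "0 \<le> C" using up b m by (meson divide_nonneg_pos of_nat_0_le_iff order_trans)
  have "real m ^ (d - 1) + K / (real m)\<^sup>2 \<le> (C ^ (d - 1) + 1 / c\<^sup>2) * K powr ?e"
    using 1 2 by (simp add: algebra_simps)
  also have "\<dots> \<le> (C ^ (d - 1) + 1 / c\<^sup>2) * n powr ?e"
    using le \<open>0 \<le> C\<close> by (intro mult_left_mono) auto
  finally show ?thesis .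
qed

text \<open>The constant in front depends only on the levels, the dimension, \<open>c\<close> and
  \<open>C\<close>. Being uniform in \<open>S\<close> and \<open>\<tau>\<close>, the bound can be
  applied outcome by outcome to randomly sampled units.\<close>

lemma multi_level_variation:
  fixes coord :: "nat \<Rightarrow> 'd::finite" and R c C :: real
  assumes coord: "bij_betw coord {1..CARD('d)} UNIV" and levels: "propensity_levels q L a k"
    and c: "0 < c" and C: "0 < C" and n: "1 \<le> n" and S: "S \<subseteq> {1..n}" "\<And>i. i \<in> S \<Longrightarrow> norm (\<psi> i) \<le> R"
    and G: "multi_level coord c C q L a k \<psi> \<tau> S G"
  defines "d \<equiv> CARD('d)"
  shows "\<bar>within_group_variation n \<psi> G\<bar>
    \<le> (\<Sum>l=1..L. 8 * real d * real (k l) * (C ^ (d - 1) + 1 / c\<^sup>2) + k l) * (R\<^sup>2 * n powr (- 2 / (real d + 1)))"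
proof -
  define e where "e = 1 - 2 / (real d + 1)"
  have d: "1 \<le> d" by (simp add: d_def Suc_leI)
  \<comment> \<open>The remainder terms \<open>k l * R\<^sup>2\<close> carry no power of
    \<open>n\<close>; this factor absorbs them into the common rate.\<close>
  have n1: "1 \<le> real n powr e" using n d by (intro ge_one_powr_ge_zero) (auto simp: e_def field_simps)
  obtain r m t H where m: "\<And>l. l \<in> {1..L} \<Longrightarrow> 1 \<le> m l"
    and grid: "\<And>l. l \<in> {1..L} \<Longrightarrow> 1 \<le> card (stratum q a k \<psi> S l - r l) \<Longrightarrow>
      c \<le> real (m l) / (real (card (stratum q a k \<psi> S l - r l)) / real (k l)) powr (1 / (real d + 1)) \<and>
      real (m l) / (real (card (stratum q a k \<psi> S l - r l)) / real (k l)) powr (1 / (real d + 1)) \<le> C"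
    and single: "\<And>l. l \<in> {1..L} \<Longrightarrow>
      single_level coord \<psi> \<tau> (k l) (m l) (t l) (stratum q a k \<psi> S l) (r l) (H l)"
    and Geq: "G = (\<Union>l\<in>{1..L}. H l)"
    using G unfolding multi_level_def Let_def d_def by blast
  define A where "A = C ^ (d - 1) + 1 / c\<^sup>2"
  define B where "B l = 8 * real d * real (k l) * R\<^sup>2 * (A * n powr e)" for l
  have H: "finite (H l) \<and> (\<Sum>g\<in>H l. variation \<psi> g) \<le> B l + k l * R\<^sup>2" if l: "l \<in> {1..L}" for l
  proof -
    define U where "U = stratum q a k \<psi> S l"
    have U: "U \<subseteq> S" by (auto simp: U_def stratum_def)
    then have U': "U - r l \<subseteq> {1..n}" "finite U" using S by (auto intro: finite_subset)
    have k: "0 < k l" using levels l by (force simp: propensity_levels_def)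
    have dvd: "k l dvd card (U - r l)" using single[OF l] by (simp add: single_level_def U_def)
    have "8 * real CARD('d) * real (k l) * R\<^sup>2
        * (real (m l) ^ (CARD('d) - 1) + (card (U - r l) div k l) / (real (m l))\<^sup>2) \<le> B l"
      if ne: "card (U - r l) \<noteq> 0"
    proof -
      have K: "real (card (U - r l) div k l) = real (card (U - r l)) / real (k l)"
        using dvd by (rule real_of_nat_div)
      have "card (U - r l) div k l \<le> card (U - r l)" by simp
      also have "\<dots> \<le> n" using card_mono[OF _ U'(1)] by simp
      finally have "real (card (U - r l) div k l) \<le> n" by simp
      then have "real (m l) ^ (d - 1) + (card (U - r l) div k l) / (real (m l))\<^sup>2
          \<le> A * n powr e"
        unfolding e_def K A_def using grid[OF l] ne m[OF l] d c k
        by (intro grid_size_bound) (auto simp: U_def)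
      then show ?thesis unfolding B_def d_def by (intro mult_left_mono) auto
    qed
    moreover have "0 \<le> B l" using C by (simp add: B_def A_def)
    ultimately show ?thesis
      using single_level_variation[OF coord m[OF l] U'(2) _ single[OF l, folded U_def] k, where R = R and B = "B l"] S U
      by blast
  qed
  have "(\<Sum>g\<in>G. variation \<psi> g) \<le> (\<Sum>l=1..L. \<Sum>g\<in>H l. variation \<psi> g)"
    unfolding Geq using H variation_nonneg by (intro sum_UN_le_sum) auto
  also have "\<dots> \<le> (\<Sum>l=1..L. B l + k l * R\<^sup>2)" using H by (intro sum_mono) auto
  also have "\<dots> \<le> (\<Sum>l=1..L. B l + k l * R\<^sup>2 * n powr e)"
    using mult_left_mono[OF n1] by (intro sum_mono add_left_mono) (metis mult.right_neutral of_nat_0_le_iff zero_le_mult_iff zero_le_power2)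
  also have "\<dots> = (\<Sum>l=1..L. 8 * real d * real (k l) * A + k l) * (R\<^sup>2 * n powr e)"
    unfolding sum_distrib_right by (intro sum.cong) (auto simp: B_def algebra_simps)
  finally have "within_group_variation n \<psi> G
      \<le> (1 / n) * ((\<Sum>l=1..L. 8 * real d * real (k l) * A + k l) * (R\<^sup>2 * n powr e))"
    unfolding within_group_variation_def variation_def[symmetric] by (rule mult_left_mono) simp
  moreover have "n powr e = n * n powr (- 2 / (real d + 1))"
    using n powr_add[of n 1 "- 2 / (real d + 1)"] by (simp add: e_def)
  moreover have "0 \<le> within_group_variation n \<psi> G"
    by (simp add: within_group_variation_def sum_nonneg)
  ultimately show ?thesis using n by (simp add: A_def)
qed

section \<open>Convergence in probability\<close>

text \<open>A union bound over \<open>n\<close> identical tails and Markov's inequality for the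
  power \<open>\<alpha>\<close> give
  \<open>n * E / (\<delta> * n powr (1 / \<beta>)) powr \<alpha>\<close>, of order
  \<open>n powr (1 - \<alpha> / \<beta>)\<close>, whose exponent is negative.\<close>

lemma (in prob_space) prob_Max_norm_small:
  fixes X :: "nat \<Rightarrow> 'a \<Rightarrow> 'b::{real_normed_vector,second_countable_topology}"
  assumes meas: "\<And>i. 1 \<le> i \<Longrightarrow> X i \<in> borel_measurable M"
    and ident: "\<And>i. 1 \<le> i \<Longrightarrow> distr M borel (X i) = distr M borel (X 1)"
    and moment: "integrable M (\<lambda>\<omega>. norm (X 1 \<omega>) powr \<alpha>)"
    and \<beta>: "0 < \<beta>" "\<beta> < \<alpha>" and \<delta>: "0 < \<delta>"
  shows "(\<lambda>n. prob (\<Union>i\<in>{1..n}. {\<omega> \<in> space M. \<delta> * real n powr (1 / \<beta>) < norm (X i \<omega>)})) \<longlonglongrightarrow> 0"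
proof (rule tendsto_sandwich[OF _ _ tendsto_const])
  define E where "E = expectation (\<lambda>\<omega>. norm (X 1 \<omega>) powr \<alpha>)"
  let ?b = "\<lambda>n. E / \<delta> powr \<alpha> * real n powr (1 - \<alpha> / \<beta>)"
  show "\<forall>\<^sub>F n in sequentially.
      prob (\<Union>i\<in>{1..n}. {\<omega> \<in> space M. \<delta> * real n powr (1 / \<beta>) < norm (X i \<omega>)}) \<le> ?b n"
  proof (rule eventually_sequentiallyI)
    fix n :: nat assume n: "1 \<le> n"
    define u where "u = \<delta> * real n powr (1 / \<beta>)"
    have u: "0 < u" using \<delta> n by (simp add: u_def)
    have ev: "{\<omega> \<in> space M. u < norm (X i \<omega>)} \<in> events" if "1 \<le> i" for i
      using meas[OF that] by measurable
    have eq: "prob {\<omega> \<in> space M. u < norm (X i \<omega>)} = prob {\<omega> \<in> space M. u < norm (X 1 \<omega>)}"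
      if "1 \<le> i" for i
    proof -
      have "{x::'b. u < norm x} \<in> sets borel" by measurable
      then have "prob {\<omega> \<in> space M. u < norm (X j \<omega>)} = measure (distr M borel (X j)) {x. u < norm x}"
        if "1 \<le> j" for j
        using meas[OF that] by (subst measure_distr) (auto intro!: arg_cong[where f = prob])
      then show ?thesis using ident[OF that] that by simp
    qed
    have "prob {\<omega> \<in> space M. u < norm (X 1 \<omega>)} \<le> prob {\<omega> \<in> space M. u powr \<alpha> \<le> norm (X 1 \<omega>) powr \<alpha>}"
      using meas[of 1] u \<beta> by (intro finite_measure_mono) (auto intro!: powr_mono2)
    also have "\<dots> \<le> E / u powr \<alpha>"
      unfolding E_def using u moment by (intro integral_Markov_inequality_measure[where A = "{}"]) auto
    finally have mk: "prob {\<omega> \<in> space M. u < norm (X 1 \<omega>)} \<le> E / u powr \<alpha>" .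
    have "prob (\<Union>i\<in>{1..n}. {\<omega> \<in> space M. u < norm (X i \<omega>)})
        \<le> (\<Sum>i\<in>{1..n}. prob {\<omega> \<in> space M. u < norm (X i \<omega>)})"
      using ev by (intro finite_measure_subadditive_finite) auto
    also have "\<dots> \<le> (\<Sum>i\<in>{1..n}. E / u powr \<alpha>)"
      proof (rule sum_mono)
      fix i assume "i \<in> {1..n}"
      then show "prob {\<omega> \<in> space M. u < norm (X i \<omega>)} \<le> E / u powr \<alpha>"
        using eq[of i] mk by simp
    qed
    also have "\<dots> = ?b n"
      using \<delta> n by (simp add: u_def powr_mult powr_powr powr_diff)
    finally show "prob (\<Union>i\<in>{1..n}. {\<omega> \<in> space M. \<delta> * real n powr (1 / \<beta>) < norm (X i \<omega>)}) \<le> ?b n"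
      by (simp add: u_def)
  qed
  have "(\<lambda>n. real n powr (1 - \<alpha> / \<beta>)) \<longlonglongrightarrow> 0"
    using \<beta> by (intro tendsto_neg_powr filterlim_real_sequentially) (simp add: field_simps)
  then show "?b \<longlonglongrightarrow> 0" by (rule tendsto_mult_right_zero)
qed simp

text \<open>For \<open>R = \<delta> * n powr (1 / \<beta>)\<close> the powers of \<open>n\<close> in
  the bound cancel and \<open>B * \<delta>\<^sup>2\<close> remains, so a large \<open>F n\<close>
  forces some norm above this \<open>R\<close>.\<close>

lemma (in prob_space) tends_to_0_in_prob_if_le_Max_norm:
  fixes X :: "nat \<Rightarrow> 'a \<Rightarrow> 'b::{real_normed_vector,second_countable_topology}"
  assumes meas: "\<And>i. 1 \<le> i \<Longrightarrow> X i \<in> borel_measurable M"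
    and ident: "\<And>i. 1 \<le> i \<Longrightarrow> distr M borel (X i) = distr M borel (X 1)"
    and moment: "integrable M (\<lambda>\<omega>. norm (X 1 \<omega>) powr \<alpha>)"
    and \<beta>: "0 < \<beta>" "\<beta> < \<alpha>" and B: "0 \<le> B"
    and bound: "\<And>n \<omega> R. 1 \<le> n \<Longrightarrow> \<omega> \<in> space M \<Longrightarrow> (\<And>i. i \<in> {1..n} \<Longrightarrow> norm (X i \<omega>) \<le> R) \<Longrightarrow>
      \<bar>F n \<omega>\<bar> \<le> B * (R\<^sup>2 * real n powr (- 2 / \<beta>))"
  shows "tends_to_0_in_prob M F"
  unfolding tends_to_0_in_prob_def
proof (intro allI impI)
  fix \<epsilon> :: real assume \<epsilon>: "0 < \<epsilon>"
  \<comment> \<open>Chosen so that \<open>B * \<delta>\<^sup>2 \<le> \<epsilon>\<close>; the added 1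
    avoids dividing by zero when \<open>B = 0\<close>.\<close>
  define \<delta> where "\<delta> = sqrt (\<epsilon> / (B + 1))"
  have \<delta>: "0 < \<delta>" using \<epsilon> B by (simp add: \<delta>_def)
  have B\<delta>: "B * \<delta>\<^sup>2 \<le> \<epsilon>" using \<epsilon> B by (simp add: \<delta>_def field_simps)
  let ?U = "\<lambda>n. \<Union>i\<in>{1..n}. {\<omega> \<in> space M. \<delta> * real n powr (1 / \<beta>) < norm (X i \<omega>)}"
  show "(\<lambda>n. prob {\<omega> \<in> space M. \<epsilon> < \<bar>F n \<omega>\<bar>}) \<longlonglongrightarrow> 0"
  proof (rule tendsto_sandwich[OF _ _ tendsto_const prob_Max_norm_small[where X = X, OF assms(1-5) \<delta>]])
    show "\<forall>\<^sub>F n in sequentially. prob {\<omega> \<in> space M. \<epsilon> < \<bar>F n \<omega>\<bar>} \<le> prob (?U n)"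
    proof (rule eventually_sequentiallyI)
      fix n :: nat assume n: "1 \<le> n"
      have "{\<omega> \<in> space M. u < norm (X i \<omega>)} \<in> events" if "1 \<le> i" for i u
        using meas[OF that] by measurable
      then have ev: "?U n \<in> events" by (intro sets.finite_UN) auto
      have sub: "\<omega> \<in> ?U n" if \<omega>: "\<omega> \<in> space M" "\<epsilon> < \<bar>F n \<omega>\<bar>" for \<omega>
      proof (rule ccontr)
        assume "\<omega> \<notin> ?U n"
        then have "norm (X i \<omega>) \<le> \<delta> * real n powr (1 / \<beta>)" if "i \<in> {1..n}" for i
          using \<omega> that by (auto simp: not_less)
        then have "\<bar>F n \<omega>\<bar> \<le> B * ((\<delta> * real n powr (1 / \<beta>))\<^sup>2 * real n powr (- 2 / \<beta>))"
          by (intro bound n \<omega>)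
        also have "(\<delta> * real n powr (1 / \<beta>))\<^sup>2 * real n powr (- 2 / \<beta>) = \<delta>\<^sup>2"
          using n by (simp add: power_mult_distrib powr_powr powr_minus powr_realpow[symmetric])
        finally show False using B\<delta> \<omega> by simp
      qed
      \<comment> \<open>Monotonicity asks for measurability of the larger set, a finite union of
        events.\<close>
      show "prob {\<omega> \<in> space M. \<epsilon> < \<bar>F n \<omega>\<bar>} \<le> prob (?U n)"
        using sub by (intro finite_measure_mono ev) blast
    qed
  qed simp
qed

section \<open>Convergence for both partitions\<close>

theorem corollary3p3:
  fixes M :: "'w measure"
    and W :: "nat \<Rightarrow> 'w \<Rightarrow> (real ^ 'd) \<times> real \<times> real"
    and \<psi> :: "nat \<Rightarrow> 'w \<Rightarrow> real ^ 'd"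
    and \<alpha> :: real
    and coord :: "nat \<Rightarrow> 'd::finite"
    and q p :: "real ^ 'd \<Rightarrow> real"
    and Lq Lp :: nat
    and aq kq ap kp :: "nat \<Rightarrow> nat"
    and N :: "nat \<Rightarrow> 'u measure"
    and \<xi> :: "nat \<Rightarrow> 'w \<Rightarrow> 'u"
    and \<tau>T \<tau>D :: "nat \<Rightarrow> 'u \<Rightarrow> nat \<Rightarrow> nat"
    and cT CT cD CD :: real
    and GT GD :: "nat \<Rightarrow> 'w \<Rightarrow> nat set set"
    and T :: "nat \<Rightarrow> nat \<Rightarrow> 'w \<Rightarrow> nat"
  assumes prob: "prob_space M"
    and indep: "prob_space.indep_vars M (\<lambda>_. borel) W {1..}"
    and ident: "\<And>i. i \<ge> 1 \<Longrightarrow> distr M borel (W i) = distr M borel (W 1)"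
    and psi: "\<And>i \<omega>. \<psi> i \<omega> = fst (W i \<omega>)"
    and alpha: "\<alpha> > real CARD('d) + 1"
    and moment: "integrable M (\<lambda>\<omega>. norm (\<psi> 1 \<omega>) powr \<alpha>)"
    and coord: "bij_betw coord {1..CARD('d)} UNIV"
    and q_range: "\<And>x. 0 < q x \<and> q x \<le> 1" and q_levels: "propensity_levels q Lq aq kq"
    and p_range: "\<And>x. 0 < p x \<and> p x < 1" and p_levels: "propensity_levels p Lp ap kp"
    and ties_indep: "\<And>n. independent_of M (\<Pi>\<^sub>M i\<in>{1..}. borel) (\<lambda>\<omega>. \<lambda>i\<in>{1..}. W i \<omega>) (N n) (\<xi> n)"
    and tiesT: "\<And>n. \<tau>T n \<in> N n \<rightarrow>\<^sub>M count_space (permutations_of_units n)"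
    and tiesD: "\<And>n. \<tau>D n \<in> N n \<rightarrow>\<^sub>M count_space (permutations_of_units n)"
    and ties_uniform: "\<And>n. distr M (count_space (permutations_of_units n \<times> permutations_of_units n))
               (\<lambda>\<omega>. (\<tau>T n (\<xi> n \<omega>), \<tau>D n (\<xi> n \<omega>))) =
             uniform_count_measure (permutations_of_units n \<times> permutations_of_units n)"
    and cT_pos: "0 < cT" and CT_pos: "0 < CT"
    and GT_info: "\<And>n. GT n \<in> info M n W (N n) (\<xi> n) \<rightarrow>\<^sub>M count_space UNIV"
    and GT_matching: "\<And>n \<omega>. \<omega> \<in> space M \<Longrightarrow>
           multi_level coord cT CT q Lq aq kq (\<lambda>i. \<psi> i \<omega>) (\<tau>T n (\<xi> n \<omega>)) {1..n} (GT n \<omega>)"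
    and T_randomized: "\<And>n. complete_randomization M (info M n W (N n) (\<xi> n)) q Lq aq kq n \<psi> (GT n) (T n)"
    and cD_pos: "0 < cD" and CD_pos: "0 < CD"
    and GD_measurable: "\<And>n. GD n \<in> M \<rightarrow>\<^sub>M count_space UNIV"
    and GD_matching: "\<And>n \<omega>. \<omega> \<in> space M \<Longrightarrow>
           multi_level coord cD CD p Lp ap kp (\<lambda>i. \<psi> i \<omega>) (\<tau>D n (\<xi> n \<omega>))
             {i \<in> {1..n}. T n i \<omega> = 1} (GD n \<omega>)"
  shows "tends_to_0_in_prob M (\<lambda>n \<omega>. within_group_variation n (\<lambda>i. \<psi> i \<omega>) (GT n \<omega>))
       \<and> tends_to_0_in_prob M (\<lambda>n \<omega>. within_group_variation n (\<lambda>i. \<psi> i \<omega>) (GD n \<omega>))"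
proof -
  interpret prob_space M by (rule prob)
  define B where "B L k c C =
      (\<Sum>l=1..L. 8 * real CARD('d) * real (k l) * (C ^ (CARD('d) - 1) + 1 / c\<^sup>2) + k l)"
    for L :: nat and k :: "nat \<Rightarrow> nat" and c C :: real
  have W: "W i \<in> borel_measurable M" if "1 \<le> i" for i
    using indep that by (auto simp: indep_vars_def)
  have fst: "fst \<in> borel_measurable (borel :: ((real ^ 'd) \<times> real \<times> real) measure)"
    by (intro borel_measurable_continuous_onI continuous_intros)
  have \<psi>_eq: "\<psi> i = fst \<circ> W i" for i by (simp add: psi fun_eq_iff)
  have meas: "\<psi> i \<in> borel_measurable M" if "1 \<le> i" for i
    unfolding \<psi>_eq using W[OF that] fst by (rule measurable_comp)
  have ident': "distr M borel (\<psi> i) = distr M borel (\<psi> 1)" if "1 \<le> i" for i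
    unfolding \<psi>_eq using distr_distr[OF fst W[OF that]] distr_distr[OF fst W[of 1]] ident[OF that] by simp
  \<comment> \<open>Stated for an arbitrary random set of units \<open>S n \<omega>\<close> inside
    \<open>{1..n}\<close>, it covers both partitions: all units for \<open>GT\<close>, the sampled
    ones for \<open>GD\<close>.\<close>
  have conv: "tends_to_0_in_prob M (\<lambda>n \<omega>. within_group_variation n (\<lambda>i. \<psi> i \<omega>) (G n \<omega>))"
    if "propensity_levels \<pi> L a k" "0 < c" "0 < C" "\<And>n \<omega>. S n \<omega> \<subseteq> {1..n}"
      and ml: "\<And>n \<omega>. \<omega> \<in> space M \<Longrightarrow>
        multi_level coord c C \<pi> L a k (\<lambda>i. \<psi> i \<omega>) (\<tau> n \<omega>) (S n \<omega>) (G n \<omega>)"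
    for \<pi> :: "real ^ 'd \<Rightarrow> real" and L a k c C S \<tau> G
  \<comment> \<open>Here \<open>\<beta>\<close> is \<open>CARD('d) + 1\<close>, so that
    \<open>alpha\<close> is the condition \<open>\<beta> < \<alpha>\<close>.\<close>
  proof (rule tends_to_0_in_prob_if_le_Max_norm[where X = \<psi> and B = "B L k c C", OF meas ident' moment _ alpha])
    show "0 \<le> B L k c C" using that by (auto simp: B_def intro!: sum_nonneg add_nonneg_nonneg)
    fix n \<omega> R
    assume "1 \<le> n" "\<omega> \<in> space M" "\<And>i. i \<in> {1..n} \<Longrightarrow> norm (\<psi> i \<omega>) \<le> R"
    then show "\<bar>within_group_variation n (\<lambda>i. \<psi> i \<omega>) (G n \<omega>)\<bar>
        \<le> B L k c C * (R\<^sup>2 * real n powr (- 2 / (real CARD('d) + 1)))"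
      using that(4)[of n \<omega>] unfolding B_def
      by (intro multi_level_variation[OF coord that(1-3) _ _ _ ml]) auto
  qed auto
  show ?thesis
  proof
    show "tends_to_0_in_prob M (\<lambda>n \<omega>. within_group_variation n (\<lambda>i. \<psi> i \<omega>) (GT n \<omega>))"
      by (rule conv[of q Lq aq kq cT CT "\<lambda>n \<omega>. {1..n}" "\<lambda>n \<omega>. \<tau>T n (\<xi> n \<omega>)" GT,
            OF q_levels cT_pos CT_pos order_refl GT_matching])
    show "tends_to_0_in_prob M (\<lambda>n \<omega>. within_group_variation n (\<lambda>i. \<psi> i \<omega>) (GD n \<omega>))"
      by (rule conv[of p Lp ap kp cD CD "\<lambda>n \<omega>. {i \<in> {1..n}. T n i \<omega> = 1}" "\<lambda>n \<omega>. \<tau>D n (\<xi> n \<omega>)" GD,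
            OF p_levels cD_pos CD_pos Collect_restrict GD_matching])
  qed
qed

end
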